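(* For each $n\ge 1$ let $\pi$ be chosen uniformly at random from $Av_n(312)$, and let $\gamma_\pi$ denote the size of the biggest sub-permutation of $\pi$ that belongs to $Av(213)$. Then the expected value $E_n(\gamma)=\frac{1}{|Av_n(312)|}\sum_{\pi\in Av_n(312)}\gamma_\pi$ satisfies $$E_n(\gamma)\sim \log_2(n)\qquad (n\to\infty),$$ i.e. $E_n(\gamma)/\log_2(n)\to 1$.
   Context: $\mathcal{S}_n$ is the set of permutations $\pi=\pi_1\pi_2\dots\pi_n$ of $\{1,\dots,n\}$ in one-line notation. $Av_n(\sigma)\subseteq \mathcal{S}_n$ is the set of permutations of size $n$ avoiding the pattern $\sigma$ in the classical sense (no subsequence, not necessarily consecutive, is order-isomorphic to $\sigma$), and $Av(\sigma)=\bigcup_n Av_n(\sigma)$. For an entry $\pi_i$ of $\pi$, let $s_\pi(\pi_i)$ be the biggest sub-string (block of consecutive positions) of $\pi$ that contains $\pi_i$ and all of whose entries are greater than or equal to $\pi_i$. The sub-permutation of $\pi$ generated by $\pi_i$, denoted $g_\pi(\pi_i)$, is the permutation obtained by rescaling $s_\pi(\pi_i)$ (replacing its entries by $1,2,\dots,|s_\pi(\pi_i)|$ in an order-preserving way). The sub-permutations of $\pi$ are the permutations $g_\pi(\pi_i)$, $1\le i\le n$. The size of a permutation is its number of entries. *)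

theory Defs
  imports
    Complex_Main
    "HOL-Library.Sublist"
    "HOL-Library.Landau_Symbols"
    "HOL-Combinatorics.Multiset_Permutations"
begin

text \<open>
  A permutation of size \<open>n\<close> is represented by its one-line notation, a list of naturals
  with entries \<open>1, \<dots>, n\<close>. \<open>subseq\<close> allows gaps between the chosen entries,
  \<open>sublist\<close> does not.
\<close>

definition perms :: "nat \<Rightarrow> nat list set" where
  "perms n = permutations_of_set {1..n}"

definition order_isomorphic :: "nat list \<Rightarrow> nat list \<Rightarrow> bool" where
  "order_isomorphic xs ys \<longleftrightarrow> length xs = length ys \<and>
     (\<forall>i<length xs. \<forall>j<length xs. xs ! i < xs ! j \<longleftrightarrow> ys ! i < ys ! j)"

definition avoids :: "nat list \<Rightarrow> nat list \<Rightarrow> bool" where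
  "avoids \<pi> \<sigma> \<longleftrightarrow> \<not> (\<exists>xs. subseq xs \<pi> \<and> order_isomorphic xs \<sigma>)"

definition Av_size :: "nat \<Rightarrow> nat list \<Rightarrow> nat list set" where
  "Av_size n \<sigma> = {\<pi> \<in> perms n. avoids \<pi> \<sigma>}"

definition Av :: "nat list \<Rightarrow> nat list set" where
  "Av \<sigma> = (\<Union>n. Av_size n \<sigma>)"

definition rescale :: "nat list \<Rightarrow> nat list" where
  "rescale xs = map (\<lambda>x. card {y \<in> set xs. y \<le> x}) xs"

text \<open>
  If \<open>\<pi>\<close> is distinct and \<open>a\<close> is one of its entries, the longest block below exists and is
  unique: the blocks containing \<open>a\<close> all overlap in the position of \<open>a\<close>, so the union of two
  admissible blocks is again admissible.
\<close>

definition gen_block :: "nat list \<Rightarrow> nat \<Rightarrow> nat list" where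
  "gen_block \<pi> a =
     (ARG_MAX length s. sublist s \<pi> \<and> a \<in> set s \<and> (\<forall>x\<in>set s. a \<le> x))"

definition gen_perm :: "nat list \<Rightarrow> nat \<Rightarrow> nat list" where
  "gen_perm \<pi> a = rescale (gen_block \<pi> a)"

definition sub_perms :: "nat list \<Rightarrow> nat list set" where
  "sub_perms \<pi> = {gen_perm \<pi> (\<pi> ! i) | i. i < length \<pi>}"

text \<open>
  For a permutation of size at least 1 the maximum is over a nonempty set, as the largest
  entry generates the permutation of size 1.
\<close>

definition max_sub_perm_213 :: "nat list \<Rightarrow> nat" where
  "max_sub_perm_213 \<pi> = Max (length ` (sub_perms \<pi> \<inter> Av [2, 1, 3]))"

definition expected_max :: "nat \<Rightarrow> real" where
  "expected_max n =
     1 / real (card (Av_size n [3, 1, 2])) *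
       (\<Sum>\<pi>\<in>Av_size n [3, 1, 2]. real (max_sub_perm_213 \<pi>))"

end

theory Submission
  imports
    Defs
    "HOL-Computational_Algebra.Formal_Power_Series"
    "HOL-Real_Asymp.Real_Asymp"
begin

text \<open>
  The minimum of a permutation avoiding 312 splits it as \<open>L 1 R\<close> with all entries of \<open>L\<close> below all
  entries of \<open>R\<close>, so these permutations correspond to binary trees, their sub-permutations to the
  nonempty subtrees, and the sub-permutations avoiding 213 to the chains (every node has at most one
  child). It remains to show that the largest chain subtree of a uniform binary tree with \<open>n\<close> nodes
  has mean size \<open>\<sim> log 2 n\<close>.

  Upper bound: the mean number of chain subtrees of size \<open>k\<close> is at most \<open>(n + 1) (k + 1) / 2 ^ (k + 1)\<close>,
  since contracting the chain leaves a tree with \<open>n - k\<close> nodes and a marked leaf; summing over \<open>k > K\<close>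
  with \<open>2 ^ K\<close> about \<open>n ln n\<close> gives \<open>K + O(1)\<close>.

  Lower bound: the generating function \<open>F\<close> of the trees without chain subtrees of size \<open>k + 1\<close>
  satisfies \<open>F = 1 + x F\<^sup>2 - 2 ^ k x ^ (k + 1)\<close>, so it still converges at \<open>x = (1 + 2 ^ -(k + 2)) / 4\<close>.
  Hence such trees have proportion \<open>O(n\<^sup>2 exp (- n / 2 ^ (k + 3)))\<close>, which is negligible for
  \<open>2 ^ k\<close> about \<open>n / (24 ln n)\<close>.
\<close>

text \<open>Otherwise the simplifier rewrites the pattern \<open>[3, 1, 2]\<close> to \<open>[3, Suc 0, 2]\<close>.\<close>

declare One_nat_def [simp del]

section \<open>Permutations avoiding 312 as binary trees\<close>

datatype tree = Tip | Node tree tree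

text \<open>Nodes are labelled \<open>s, s + 1, \<dots>\<close> in preorder, and the labels are listed in inorder.\<close>

fun lab :: "nat \<Rightarrow> tree \<Rightarrow> nat list" where
  "lab s Tip = []"
| "lab s (Node l r) = lab (Suc s) l @ s # lab (Suc s + size l) r"

fun chain :: "tree \<Rightarrow> bool" where
  "chain Tip = True"
| "chain (Node l r) = (l = Tip \<and> chain r \<or> r = Tip \<and> chain l)"

definition trees :: "nat \<Rightarrow> tree set" where
  "trees n = {t. size t = n}"

fun subtrees :: "tree \<Rightarrow> tree set" where
  "subtrees Tip = {}"
| "subtrees (Node l r) = insert (Node l r) (subtrees l \<union> subtrees r)"

text \<open>Each node is recorded by its preorder label, the entry that generates the block of its
  subtree. The label keeps apart equal subtrees at different nodes, which \<open>subtrees\<close>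
  identifies.\<close>

fun occs :: "nat \<Rightarrow> tree \<Rightarrow> (nat \<times> tree) set" where
  "occs s Tip = {}"
| "occs s (Node l r) =
    insert (s, Node l r) (occs (Suc s) l \<union> occs (Suc s + size l) r)"

lemma length_lab [simp]: "length (lab s t) = size t"
  by (induction s t rule: lab.induct) auto

lemma lab_eq_Nil_iff [simp]: "lab s t = [] \<longleftrightarrow> t = Tip"
  by (cases t) auto

lemma set_lab: "set (lab s t) = {s..<s + size t}"
  by (induction s t rule: lab.induct) auto

lemma distinct_lab: "distinct (lab s t)"
  by (induction s t rule: lab.induct) (auto simp: set_lab)

lemma lab_add: "lab (s + d) t = map (\<lambda>x. x + d) (lab s t)"
proof (induction t arbitrary: s)
  case (Node l r)
  show ?case
    using Node(1)[of "Suc s"] Node(2)[of "Suc s + size l"] by (simp add: add_ac)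
qed auto

lemma rescale_lab:
  assumes "s \<ge> 1"
  shows "rescale (lab s t) = lab 1 t"
proof -
  have "card {y \<in> set (lab s t). y \<le> x} = x - (s - 1)" if "x \<in> set (lab s t)" for x
  proof -
    have "{y \<in> set (lab s t). y \<le> x} = {s..x}"
      using that by (auto simp: set_lab)
    then show ?thesis using assms by simp
  qed
  then have "rescale (lab s t) = map (\<lambda>x. x - (s - 1)) (lab s t)"
    unfolding rescale_def by (intro map_cong) auto
  also have "\<dots> = map (\<lambda>x. x - (s - 1)) (map (\<lambda>x. x + (s - 1)) (lab 1 t))"
    using lab_add[of 1 "s - 1" t] assms by simp
  also have "\<dots> = lab 1 t" by (simp add: comp_def)
  finally show ?thesis .
qed

section \<open>Pattern avoidance of labelled trees\<close>

lemma order_isomorphic_3: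
  "order_isomorphic [x, y, z] [x', y', z'] \<longleftrightarrow>
    (x < y \<longleftrightarrow> x' < y') \<and> (x < z \<longleftrightarrow> x' < z') \<and> (y < z \<longleftrightarrow> y' < z') \<and>
    (y < x \<longleftrightarrow> y' < x') \<and> (z < x \<longleftrightarrow> z' < x') \<and> (z < y \<longleftrightarrow> z' < y')"
  by (simp add: order_isomorphic_def All_less_Suc conj_ac)

lemma avoids_312_iff:
  "avoids \<pi> [3, 1, 2] \<longleftrightarrow> (\<forall>a b c. subseq [c, a, b] \<pi> \<longrightarrow> \<not> (a < b \<and> b < c))"
proof -
  have "order_isomorphic xs [3, 1, 2] \<longleftrightarrow> (\<exists>a b c. xs = [c, a, b] \<and> a < b \<and> b < c)" for xs
  proof
    assume *: "order_isomorphic xs [3, 1, 2]"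
    then obtain c a b where "xs = [c, a, b]"
      by (auto simp: order_isomorphic_def length_Suc_conv)
    with * show "\<exists>a b c. xs = [c, a, b] \<and> a < b \<and> b < c"
      by (simp add: order_isomorphic_3)
  qed (auto simp: order_isomorphic_3)
  then show ?thesis unfolding avoids_def by metis
qed

lemma avoids_213_iff:
  "avoids \<pi> [2, 1, 3] \<longleftrightarrow> (\<forall>a b c. subseq [b, a, c] \<pi> \<longrightarrow> \<not> (a < b \<and> b < c))"
proof -
  have "order_isomorphic xs [2, 1, 3] \<longleftrightarrow> (\<exists>a b c. xs = [b, a, c] \<and> a < b \<and> b < c)" for xs
  proof
    assume *: "order_isomorphic xs [2, 1, 3]"
    then obtain b a c where "xs = [b, a, c]"
      by (auto simp: order_isomorphic_def length_Suc_conv)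
    with * show "\<exists>a b c. xs = [b, a, c] \<and> a < b \<and> b < c"
      by (simp add: order_isomorphic_3)
  qed (auto simp: order_isomorphic_3)
  then show ?thesis unfolding avoids_def by metis
qed

lemma avoids_subseq: "avoids \<pi> \<sigma> \<Longrightarrow> subseq \<rho> \<pi> \<Longrightarrow> avoids \<rho> \<sigma>"
  unfolding avoids_def using subseq_order.order_trans[of _ \<rho> \<pi>] by blast

lemma set_subseq: "subseq xs ys \<Longrightarrow> x \<in> set xs \<Longrightarrow> x \<in> set ys"
  by (elim list_emb_set) auto

lemma subseq3_appendE:
  assumes "subseq [x, y, z] (xs @ ys)"
  obtains "subseq [x, y, z] xs" | "subseq [x, y] xs" "z \<in> set ys"
    | "x \<in> set xs" "subseq [y, z] ys" | "subseq [x, y, z] ys"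
  using assms
  by (auto simp: subseq_append_iff Cons_eq_append_conv subseq_singleton_left)

text \<open>All labels of \<open>l\<close> are below those of \<open>r\<close>, so the 3 cannot lie
  in \<open>l\<close> while the 2 lies in \<open>r\<close>; the root label, being the least, could
  only play the 1.\<close>

lemma avoids_312_lab: "avoids (lab s t) [3, 1, 2]"
proof (induction s t rule: lab.induct)
  case (1 s)
  show ?case unfolding avoids_312_iff by simp
next
  case (2 s l r)
  let ?L = "lab (Suc s) l" and ?R = "lab (Suc s + size l) r"
  show ?case
    unfolding avoids_312_iff
  proof (intro allI impI notI)
    fix a b c assume sub: "subseq [c, a, b] (lab s (Node l r))" and lt: "a < b \<and> b < c"
    have "subseq [c, a, b] (?L @ [s] @ ?R)" using sub by simp
    then show False
    proof (cases rule: subseq3_appendE)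
      case 1
      then show False using "2.IH"(1) lt unfolding avoids_312_iff by blast
    next
      case 2
      from 2(1) have "a \<in> set ?L" "c \<in> set ?L" by (auto dest: set_subseq)
      then show False using 2(2) lt by (auto simp: set_lab)
    next
      case 3
      then have "b \<in> set ?R"
        by (auto dest: set_subseq[where x = b] simp: subseq_singleton_left split: if_splits)
      then show False using 3 lt by (auto simp: set_lab)
    next
      case 4
      show False
      proof (cases "c = s")
        case True
        from 4 have "a \<in> set ([s] @ ?R)" by (rule set_subseq) simp
        then show False using True lt by (auto simp: set_lab)
      next
        case False
        then have "subseq [c, a, b] ?R" using 4 by simp
        then show False using "2.IH"(2) lt unfolding avoids_312_iff by blast
      qed
    qed
  qed
qed

text \<open>The labels of the left child, the root and the right child of a node with two children
  form a 213. With one child the root label stands at an end of the list, but being the least it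
  could only play the 1, which is in the middle.\<close>

lemma avoids_213_lab: "avoids (lab s t) [2, 1, 3] \<longleftrightarrow> chain t"
proof (induction s t rule: lab.induct)
  case (1 s)
  show ?case unfolding avoids_213_iff by simp
next
  case (2 s l r)
  let ?L = "lab (Suc s) l" and ?R = "lab (Suc s + size l) r"
  show ?case
  proof
    assume av: "avoids (lab s (Node l r)) [2, 1, 3]"
    have "l = Tip \<or> r = Tip"
    proof (rule ccontr)
      assume "\<not> ?thesis"
      then have "Suc s \<in> set ?L" "Suc s + size l \<in> set ?R" "size l > 0"
        by (cases l; cases r; auto simp: set_lab)+
      moreover from this have "subseq ([Suc s] @ [s] @ [Suc s + size l]) (?L @ [s] @ ?R)"
        by (intro list_emb_append_mono) (auto simp: subseq_singleton_left)
      ultimately show False using av unfolding avoids_213_iff by (auto dest!: spec)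
    qed
    moreover have "avoids ?L [2, 1, 3]" "avoids ?R [2, 1, 3]"
      by (rule avoids_subseq[OF av]; auto intro: list_emb_append2)+
    ultimately show "chain (Node l r)" using 2 by auto
  next
    assume ch: "chain (Node l r)"
    show "avoids (lab s (Node l r)) [2, 1, 3]"
      unfolding avoids_213_iff
    proof (intro allI impI notI)
      fix a b c assume sub: "subseq [b, a, c] (lab s (Node l r))" and lt: "a < b \<and> b < c"
      consider "l = Tip" "chain r" | "r = Tip" "chain l" using ch by auto
      then show False
      proof cases
        case 1
        then have sub': "subseq [b, a, c] (s # ?R)" using sub by simp
        show False
        proof (cases "b = s")
          case True
          from sub' have "a \<in> set (s # ?R)" by (rule set_subseq) simp
          then show False using True lt by (auto simp: set_lab)
        next
          case False
          then have "subseq [b, a, c] ?R" using sub' by simp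
          then show False using "2.IH"(2) 1 lt unfolding avoids_213_iff by blast
        qed
      next
        case 2
        then have "subseq [b, a, c] (?L @ [s])" using sub by simp
        then show False
        proof (cases rule: subseq3_appendE)
          case 1
          then show False using "2.IH"(1) 2 lt unfolding avoids_213_iff by blast
        next
          case 2
          then have "b \<in> set ?L" by (auto dest: set_subseq)
          then show False using 2 lt by (auto simp: set_lab)
        qed (auto split: if_splits)
      qed
    qed
  qed
qed

section \<open>Inverting the labelling\<close>

lemma interval_split:
  fixes A B :: "nat set"
  assumes "A \<union> B = {m..<n}" and "\<And>x y. x \<in> A \<Longrightarrow> y \<in> B \<Longrightarrow> x < y"
    and "m \<le> n"
  shows "A = {m..<m + card A}" "B = {m + card A..<n}"
proof -
  have fin: "finite A" "finite B"
    using assms(1) finite_Un[of A B] by auto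
  have sub: "x \<in> {m..<n}" if "x \<in> A \<or> x \<in> B" for x
    using that unfolding assms(1)[symmetric] by blast
  \<comment> \<open>The cut point; inserting \<open>n\<close> provides its value when
    \<open>B\<close> is empty.\<close>
  define c where "c = Min (insert n B)"
  have c_le: "c \<le> n" "\<And>y. y \<in> B \<Longrightarrow> c \<le> y" unfolding c_def using fin by auto
  have c_in: "c = n \<or> c \<in> B" unfolding c_def using Min_in[of "insert n B"] fin by auto
  have A_less: "x < c" if "x \<in> A" for x
    using c_in assms(2)[OF that] sub[of x] that by auto
  have m_le: "m \<le> c" using c_in sub[of c] assms(3) by auto
  have in_Un: "x \<in> A \<or> x \<in> B" if "m \<le> x" "x < n" for x
    using that assms(1) by (metis Un_iff atLeastLessThan_iff)
  have A: "A = {m..<c}"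
  proof (intro equalityI subsetI)
    fix x assume "x \<in> {m..<c}"
    then show "x \<in> A" using in_Un[of x] c_le(1) c_le(2)[of x] by auto
  qed (use sub A_less in auto)
  have B: "B = {c..<n}"
  proof (intro equalityI subsetI)
    fix x assume "x \<in> {c..<n}"
    then show "x \<in> B" using in_Un[of x] m_le A_less[of x] by auto
  qed (use sub c_le in auto)
  show "A = {m..<m + card A}" "B = {m + card A..<n}"
    using A B m_le by auto
qed

text \<open>Around the least entry \<open>s\<close>, avoidance of 312 puts every earlier entry below
  every later one. The two sides then carry consecutive intervals, which are the label ranges that
  \<open>lab\<close> assigns to the two subtrees.\<close>

lemma lab_surj:
  assumes "distinct \<pi>" "set \<pi> = {s..<s + n}" "avoids \<pi> [3, 1, 2]"
  shows "\<exists>t. lab s t = \<pi>"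
  using assms
proof (induction n arbitrary: s \<pi> rule: less_induct)
  case (less n)
  show ?case
  proof (cases "n = 0")
    case True
    then have "lab s Tip = \<pi>" using less.prems by simp
    then show ?thesis by blast
  next
    case False
    then have "s \<in> set \<pi>" using less.prems by auto
    then obtain L R where \<pi>: "\<pi> = L @ s # R" by (meson split_list)
    have dist: "distinct L" "distinct R" "s \<notin> set L" "s \<notin> set R" "set L \<inter> set R = {}"
      using less.prems(1) \<pi> by auto
    have un: "set L \<union> set R = {Suc s..<s + n}"
    proof -
      have "set L \<union> set R = set \<pi> - {s}" using dist \<pi> by auto
      also have "\<dots> = {Suc s..<s + n}" unfolding less.prems(2) by auto
      finally show ?thesis .
    qed
    have LR: "x < y" if "x \<in> set L" "y \<in> set R" for x y
    proof -
      have "subseq ([x] @ [s] @ [y]) (L @ [s] @ R)"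
        using that by (intro list_emb_append_mono) (auto simp: subseq_singleton_left)
      then have "subseq [x, s, y] \<pi>" by (simp add: \<pi>)
      then have "\<not> (s < y \<and> y < x)" using less.prems(3) unfolding avoids_312_iff by blast
      moreover have "y \<in> {Suc s..<s + n}" using that unfolding un[symmetric] by simp
      moreover have "x \<noteq> y" using dist that by auto
      ultimately show ?thesis by auto
    qed
    have cards: "card (set L) = length L" "card (set R) = length R"
      using dist by (auto simp: distinct_card)
    note split = interval_split[OF un LR, unfolded cards]
    have L: "set L = {Suc s..<Suc s + length L}" and R: "set R = {Suc s + length L..<s + n}"
      using split False by auto
    have "length R = s + n - (Suc s + length L)" using cards(2) R by simp
    moreover have "length \<pi> = n" using distinct_card[OF less.prems(1)] less.prems(2) by simp
    ultimately have len: "length L < n" "length R < n" "s + n = Suc s + length L + length R"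
      using \<pi> by auto
    have "suffix R \<pi>" unfolding \<pi> by (simp add: suffix_def)
    then have "subseq L \<pi>" "subseq R \<pi>" by (auto simp: \<pi> intro: prefix_imp_subseq suffix_imp_subseq)
    then have "avoids L [3, 1, 2]" "avoids R [3, 1, 2]"
      by (auto intro: avoids_subseq[OF less.prems(3)])
    moreover have "set R = {Suc s + length L..<Suc s + length L + length R}"
      using R len(3) by simp
    ultimately obtain l r where l: "lab (Suc s) l = L" and r: "lab (Suc s + length L) r = R"
      using less.IH[OF len(1) dist(1) L] less.IH[OF len(2) dist(2)] by blast
    have "size l = length L" using l by (metis length_lab)
    then have "lab s (Node l r) = \<pi>" using l r \<pi> by simp
    then show ?thesis by blast
  qed
qed

text \<open>The root label occurs once and so determines the split; equality of the left subtrees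
  then makes the starting labels on the right agree.\<close>

lemma lab_inj: "lab s t = lab s u \<Longrightarrow> t = u"
proof (induction s t arbitrary: u rule: lab.induct)
  case (1 s)
  then show ?case by (metis lab_eq_Nil_iff)
next
  case (2 s l r)
  then have "u \<noteq> Tip" by auto
  then obtain l' r' where u: "u = Node l' r'" by (cases u) auto
  have "lab (Suc s) l @ s # lab (Suc s + size l) r = lab (Suc s) l' @ s # lab (Suc s + size l') r'"
    using 2 u by simp
  moreover have "s \<notin> set (lab (Suc s) l)" "s \<notin> set (lab (Suc s + size l) r)"
    by (auto simp: set_lab)
  ultimately have *: "lab (Suc s) l = lab (Suc s) l'" "lab (Suc s + size l) r = lab (Suc s + size l') r'"
    by (simp_all only: append_Cons_eq_iff simp_thms)
  then have "l = l'" using "2.IH"(1) by blast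
  then show ?case using * "2.IH"(2) u by auto
qed

lemma Av_312_eq: "Av_size n [3, 1, 2] = lab 1 ` trees n"
proof (intro equalityI subsetI)
  fix \<pi> assume "\<pi> \<in> Av_size n [3, 1, 2]"
  then have \<pi>: "distinct \<pi>" "set \<pi> = {1..<1 + n}" "avoids \<pi> [3, 1, 2]"
    by (auto simp: Av_size_def perms_def permutations_of_set_def)
  then obtain t where t: "lab 1 t = \<pi>" using lab_surj by blast
  have "size t = length \<pi>" using t by (metis length_lab)
  also have "\<dots> = n" using \<pi> distinct_card[OF \<pi>(1)] by simp
  finally show "\<pi> \<in> lab 1 ` trees n" using t by (auto simp: trees_def)
next
  fix \<pi> assume "\<pi> \<in> lab 1 ` trees n"
  then show "\<pi> \<in> Av_size n [3, 1, 2]"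
    using avoids_312_lab distinct_lab
    by (auto simp: trees_def Av_size_def perms_def permutations_of_set_def set_lab)
qed

lemma inj_on_lab: "inj_on (lab s) A"
  using lab_inj by (auto simp: inj_on_def)

lemma lab_in_Av_213_iff: "lab 1 t \<in> Av [2, 1, 3] \<longleftrightarrow> chain t"
proof -
  have "lab 1 t \<in> perms (size t)"
    by (simp add: perms_def permutations_of_set_def set_lab distinct_lab) auto
  then show ?thesis
    unfolding Av_def Av_size_def using avoids_213_lab by blast
qed

section \<open>Blocks generated by the entries of a labelled tree\<close>

lemma gen_block_eqI:
  assumes dist: "distinct (xs @ b @ ys)" and a: "a \<in> set b" and ge: "\<forall>x\<in>set b. a \<le> x"
    and xs: "xs = [] \<or> last xs < a" and ys: "ys = [] \<or> hd ys < a"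
  shows "gen_block (xs @ b @ ys) a = b"
proof -
  let ?w = "xs @ b @ ys"
  let ?P = "\<lambda>s. sublist s ?w \<and> a \<in> set s \<and> (\<forall>x\<in>set s. a \<le> x)"
  obtain j where j: "j < length b" "b ! j = a" using a by (auto simp: in_set_conv_nth)
  \<comment> \<open>Since \<open>ARG_MAX\<close> selects some maximiser, \<open>b\<close> must be
    the only one: every other admissible block is strictly shorter.\<close>
  have len: "length s \<le> length b \<and> (length s = length b \<longrightarrow> s = b)" if s: "?P s" for s
  proof -
    obtain p q where w: "?w = p @ s @ q" using s by (auto simp: sublist_def)
    obtain i where i: "i < length s" "s ! i = a" using s by (auto simp: in_set_conv_nth)
    have wi: "?w ! (length p + k) = s ! k" if "k < length s" for k
      using that by (subst w) (simp add: nth_append)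
    have wj: "?w ! (length xs + j) = a" using j by (simp add: nth_append)
    have lw: "length xs + length b + length ys = length p + length s + length q"
      using arg_cong[OF w, of length] by simp
    \<comment> \<open>Entries are distinct, so \<open>s\<close> and \<open>b\<close> cover the same
      position of \<open>a\<close>.\<close>
    have ij: "length p + i = length xs + j"
      using nth_eq_iff_index_eq[OF dist, of "length p + i" "length xs + j"] wi[OF i(1)] wj i j lw
      by auto
    have s_ge: "a \<le> s ! k" if "k < length s" for k
      using that s by auto
    have "length xs \<le> length p"
    proof (rule ccontr)
      assume "\<not> ?thesis"
      then have lt: "length p < length xs" by simp
      then have "xs \<noteq> []" by auto
      \<comment> \<open>The index in \<open>s\<close> of the last entry of \<open>xs\<close>: a
        block that starts to the left of \<open>b\<close> contains this entry, which is below
        \<open>a\<close>.\<close>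
      define k where "k = length xs - 1 - length p"
      have k: "k < length s" "length p + k = length xs - 1"
        using lt ij i unfolding k_def by auto
      have "s ! k = last xs"
        using wi[OF k(1)] k(2) \<open>xs \<noteq> []\<close> by (simp add: nth_append last_conv_nth)
      then show False using xs \<open>xs \<noteq> []\<close> s_ge[OF k(1)] by auto
    qed
    moreover have "length p + length s \<le> length xs + length b"
    proof (rule ccontr)
      assume "\<not> ?thesis"
      then have lt: "length p + length s > length xs + length b" by simp
      then have "ys \<noteq> []" using lw by auto
      define k where "k = length xs + length b - length p"
      have k: "k < length s" "length p + k = length xs + length b"
        using lt ij i j unfolding k_def by auto
      have "s ! k = hd ys"
        using wi[OF k(1)] k(2) \<open>ys \<noteq> []\<close> by (simp add: nth_append hd_conv_nth)
      then show False using ys \<open>ys \<noteq> []\<close> s_ge[OF k(1)] by auto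
    qed
    moreover have "s = b" if "length p = length xs" "length s = length b"
      using w that by simp
    ultimately show ?thesis by linarith
  qed
  have Pb: "?P b" using a ge sublist_appendI by blast
  show ?thesis
    unfolding gen_block_def
  proof (rule arg_maxI[where P = ?P and x = b])
    show "\<not> length b < length s" if "?P s" for s
      using len[OF that] by simp
    show "s = b" if "?P s" "\<forall>s'. ?P s' \<longrightarrow> \<not> length s < length s'" for s
    proof (rule ccontr)
      assume "s \<noteq> b"
      then have "length s < length b" using len[OF that(1)] by auto
      then show False using that(2) Pb by blast
    qed
  qed (fact Pb)
qed

lemma occs_fst: "fst ` occs s t = set (lab s t)"
  by (induction s t rule: occs.induct) (auto simp: image_Un)

lemma occs_snd: "snd ` occs s t = subtrees t"
  by (induction s t rule: occs.induct) (auto simp: image_Un)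

text \<open>The neighbours of the block of a subtree in inorder belong to ancestors, whose preorder
  labels are smaller. In the induction the only possible new neighbour is the root label
  \<open>s\<close>.\<close>

lemma occs_block:
  assumes "(a, u) \<in> occs s t"
  shows "s \<le> a \<and> u \<noteq> Tip \<and> (\<exists>xs ys. lab s t = xs @ lab a u @ ys \<and>
    (xs = [] \<or> last xs < a) \<and> (ys = [] \<or> hd ys < a))"
  using assms
proof (induction s t rule: occs.induct)
  case (1 s)
  then show ?case by simp
next
  case (2 s l r)
  consider "a = s" "u = Node l r" | "(a, u) \<in> occs (Suc s) l"
    | "(a, u) \<in> occs (Suc s + size l) r"
    using 2(3) by auto
  then show ?case
  proof cases
    case 1
    then show ?thesis by (auto intro!: exI[of _ "[]"])
  next
    case c: 2
    obtain xs ys where *: "Suc s \<le> a" "u \<noteq> Tip" "lab (Suc s) l = xs @ lab a u @ ys"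
      "xs = [] \<or> last xs < a" "ys = [] \<or> hd ys < a"
      using "2.IH"(1)[OF c] by blast
    then have "lab s (Node l r) = xs @ lab a u @ (ys @ s # lab (Suc s + size l) r)" by simp
    moreover have "hd (ys @ s # lab (Suc s + size l) r) < a" using * by (cases ys) auto
    ultimately show ?thesis using * by (metis Suc_leD)
  next
    case c: 3
    obtain xs ys where *: "Suc s + size l \<le> a" "u \<noteq> Tip" "lab (Suc s + size l) r = xs @ lab a u @ ys"
      "xs = [] \<or> last xs < a" "ys = [] \<or> hd ys < a"
      using "2.IH"(2)[OF c] by blast
    then have "lab s (Node l r) = (lab (Suc s) l @ s # xs) @ lab a u @ ys" by simp
    moreover have "last (lab (Suc s) l @ s # xs) < a" using * by auto
    moreover have "s \<le> a" using * by simp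
    ultimately show ?thesis using * by blast
  qed
qed

lemma gen_perm_lab:
  assumes "(a, u) \<in> occs 1 t"
  shows "gen_perm (lab 1 t) a = lab 1 u"
proof -
  obtain xs ys where *: "1 \<le> a" "u \<noteq> Tip" "lab 1 t = xs @ lab a u @ ys"
    "xs = [] \<or> last xs < a" "ys = [] \<or> hd ys < a"
    using occs_block[OF assms] by blast
  have "size u > 0" using *(2) by (cases u) auto
  then have "gen_block (lab 1 t) a = lab a u"
    unfolding *(3) using * distinct_lab[of 1 t] by (intro gen_block_eqI) (auto simp: set_lab)
  then show ?thesis by (simp add: gen_perm_def rescale_lab *(1))
qed

lemma sub_perms_lab: "sub_perms (lab 1 t) = lab 1 ` subtrees t"
proof -
  have "sub_perms (lab 1 t) = gen_perm (lab 1 t) ` set (lab 1 t)"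
    unfolding sub_perms_def set_conv_nth by blast
  also have "\<dots> = (\<lambda>p. gen_perm (lab 1 t) (fst p)) ` occs 1 t"
    by (simp add: image_image flip: occs_fst)
  also have "\<dots> = (\<lambda>p. lab 1 (snd p)) ` occs 1 t"
    by (intro image_cong) (auto simp: gen_perm_lab)
  also have "\<dots> = lab 1 ` subtrees t"
    by (simp add: image_image flip: occs_snd[of 1])
  finally show ?thesis .
qed

definition max_chain :: "tree \<Rightarrow> nat" where
  "max_chain t = Max (size ` {u \<in> subtrees t. chain u})"

lemma max_sub_perm_213_lab: "max_sub_perm_213 (lab 1 t) = max_chain t"
proof -
  have "sub_perms (lab 1 t) \<inter> Av [2, 1, 3] = lab 1 ` {u \<in> subtrees t. chain u}"
    unfolding sub_perms_lab using lab_in_Av_213_iff by blast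
  then show ?thesis by (simp add: max_sub_perm_213_def max_chain_def image_image)
qed

section \<open>Catalan numbers\<close>

lemma size_eq_0_iff [simp]: "size (t :: tree) = 0 \<longleftrightarrow> t = Tip"
  by (cases t) auto

lemma trees_0: "trees 0 = {Tip}"
  by (auto simp: trees_def)

lemma trees_Suc: "trees (Suc n) = (\<Union>i\<le>n. (\<lambda>(l, r). Node l r) ` (trees i \<times> trees (n - i)))"
proof (intro equalityI subsetI)
  fix t assume "t \<in> trees (Suc n)"
  then obtain l r where t: "t = Node l r" "size l + size r = n"
    by (cases t) (auto simp: trees_def)
  then have "size l \<le> n" "(l, r) \<in> trees (size l) \<times> trees (n - size l)"
    by (auto simp: trees_def)
  then show "t \<in> (\<Union>i\<le>n. (\<lambda>(l, r). Node l r) ` (trees i \<times> trees (n - i)))"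
    using t by (intro UN_I[of "size l"]) auto
qed (auto simp: trees_def)

lemma finite_trees [simp]: "finite (trees n)"
proof (induction n rule: less_induct)
  case (less n)
  show ?case
  proof (cases n)
    case (Suc m)
    have "finite (trees i \<times> trees (m - i))" if "i \<le> m" for i
      using less.IH[of i] less.IH[of "m - i"] that Suc by auto
    then show ?thesis unfolding Suc trees_Suc by blast
  qed (simp add: trees_0)
qed

lemma sum_trees_Suc:
  "(\<Sum>t\<in>trees (Suc n). f t) = (\<Sum>i\<le>n. \<Sum>l\<in>trees i. \<Sum>r\<in>trees (n - i). f (Node l r))"
proof -
  have "(\<Sum>t\<in>trees (Suc n). f t)
      = (\<Sum>i\<le>n. \<Sum>t\<in>(\<lambda>(l, r). Node l r) ` (trees i \<times> trees (n - i)). f t)"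
    unfolding trees_Suc
    by (intro sum.UNION_disjoint ballI finite_imageI finite_cartesian_product finite_trees finite_atMost)
      (auto simp: trees_def)
  also have "\<dots> = (\<Sum>i\<le>n. \<Sum>(l, r)\<in>trees i \<times> trees (n - i). f (Node l r))"
    by (intro sum.cong refl, subst sum.reindex) (auto simp: inj_on_def case_prod_unfold)
  finally show ?thesis by (simp add: sum.cartesian_product)
qed

definition catalan :: "nat \<Rightarrow> real" where
  "catalan n = real (card (trees n))"

lemma sum_antidiagonal_swap: "(\<Sum>i\<le>n. f i (n - i)) = (\<Sum>i\<le>n. f (n - i) i)" for n :: nat
  by (rule sum.reindex_bij_witness[of _ "\<lambda>i. n - i" "\<lambda>i. n - i"]) auto

lemma catalan_0 [simp]: "catalan 0 = 1"
  by (simp add: catalan_def trees_0)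

lemma catalan_Suc: "catalan (Suc n) = (\<Sum>i\<le>n. catalan i * catalan (n - i))"
proof -
  have "catalan (Suc n) = (\<Sum>t\<in>trees (Suc n). 1)" by (simp add: catalan_def)
  then show ?thesis unfolding sum_trees_Suc by (simp add: catalan_def)
qed

text \<open>
  The series \<open>G = X C\<close> satisfies \<open>G = X + G\<^sup>2\<close>, so that \<open>(1 - 2 G)\<^sup>2 = 1 - 4 X\<close> and
  \<open>G' (1 - 4 X) = 1 - 2 G\<close>.
\<close>

lemma catalan_ratio: "real (n + 2) * catalan (Suc n) = real (4 * n + 2) * catalan n"
proof -
  define F where "F = Abs_fps catalan"
  define G where "G = fps_X * F"
  have "F = 1 + fps_X * (F * F)"
  proof (rule fps_ext)
    fix n
    have "fps_nth (F * F) m = catalan (Suc m)" for m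
      by (simp add: F_def catalan_Suc fps_mult_nth atLeast0AtMost)
    then show "fps_nth F n = fps_nth (1 + fps_X * (F * F)) n"
      by (cases n) (auto simp: F_def)
  qed
  then have "G = fps_X * (1 + fps_X * (F * F))" unfolding G_def by (rule arg_cong)
  also have "\<dots> = fps_X + G * G" by (simp add: G_def algebra_simps)
  finally have G: "G = fps_X + G * G" .
  then have "fps_deriv G = fps_deriv (fps_X + G * G)" by simp
  then have G': "fps_deriv G * (1 - 2 * G) = 1" by (simp add: algebra_simps)
  have "(1 - 2 * G) * (1 - 2 * G) = 1 - 4 * (G - G * G)" by (simp add: algebra_simps)
  also have "G - G * G = fps_X" using G by (metis add_diff_cancel_right')
  finally have sq: "(1 - 2 * G) * (1 - 2 * G) = 1 - 4 * fps_X" .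
  have "fps_deriv G * (1 - 4 * fps_X) = 1 - 2 * G"
    unfolding sq[symmetric] using G' by (simp flip: mult.assoc)
  then have "fps_deriv G - fps_const 4 * (fps_X * fps_deriv G) = 1 - fps_const 2 * G"
    by (simp add: numeral_fps_const algebra_simps)
  then have "fps_nth (fps_deriv G - fps_const 4 * (fps_X * fps_deriv G)) (Suc n)
      = fps_nth (1 - fps_const 2 * G) (Suc n)" by (rule arg_cong)
  then have "fps_nth (fps_deriv G) (Suc n) - 4 * fps_nth (fps_deriv G) n = - (2 * catalan n)"
    by (simp add: G_def F_def del: fps_deriv_nth fps_deriv_mult)
  moreover have "fps_nth (fps_deriv G) m = real (m + 1) * catalan m" for m
  proof -
    have "fps_nth G (Suc m) = catalan m" by (simp add: G_def F_def)
    then show ?thesis unfolding fps_deriv_nth Suc_eq_plus1 by simp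
  qed
  ultimately show ?thesis by (simp add: algebra_simps del: fps_deriv_nth)
qed

text \<open>Trees with \<open>n\<close> nodes and a marked leaf; this is the central binomial
  coefficient.\<close>

definition leaf_count :: "nat \<Rightarrow> real" where
  "leaf_count n = real (n + 1) * catalan n"

lemma catalan_pos: "catalan n > 0"
proof (induction n)
  case (Suc n)
  have "real (n + 2) * catalan (Suc n) > 0" unfolding catalan_ratio using Suc by simp
  then show ?case by (simp add: zero_less_mult_iff)
qed auto

lemma leaf_count_0 [simp]: "leaf_count 0 = 1"
  by (simp add: leaf_count_def)

lemma leaf_count_pos: "leaf_count n > 0"
  using catalan_pos by (simp add: leaf_count_def)

lemma leaf_count_Suc: "real (n + 1) * leaf_count (Suc n) = real (4 * n + 2) * leaf_count n"
proof -
  have "real (n + 1) * leaf_count (Suc n) = real (n + 1) * (real (n + 2) * catalan (Suc n))"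
    by (simp add: leaf_count_def)
  also have "\<dots> = real (4 * n + 2) * leaf_count n"
    unfolding catalan_ratio by (simp add: leaf_count_def)
  finally show ?thesis .
qed

text \<open>The ratio of consecutive values at index \<open>m + k\<close> is
  \<open>4 - 2 / (m + k + 1)\<close>, at least \<open>4 (k + 1) / (k + 2)\<close>. These factors
  telescope, so only \<open>k + 1\<close> is lost.\<close>

lemma leaf_count_growth: "4 ^ k * leaf_count m \<le> real (k + 1) * leaf_count (m + k)"
proof (induction k)
  case (Suc k)
  let ?b = "leaf_count (m + k)" and ?c = "leaf_count (m + Suc k)"
  have "real (k + 1) * real (m + k + 1) * (4 * ?b) \<le> real (k + 2) * (real (4 * (m + k) + 2) * ?b)"
  proof -
    have "(real (k + 1) * real (m + k + 1) * 4) * ?b \<le> (real (k + 2) * real (4 * (m + k) + 2)) * ?b"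
      using leaf_count_pos[of "m + k"] by (intro mult_right_mono) (auto simp: algebra_simps)
    then show ?thesis by (simp only: mult.assoc)
  qed
  also have "\<dots> = real (m + k + 1) * (real (k + 2) * ?c)"
    using leaf_count_Suc[of "m + k"] by (simp add: mult_ac)
  finally have "real (m + k + 1) * (4 * (real (k + 1) * ?b)) \<le> real (m + k + 1) * (real (k + 2) * ?c)"
    by (simp only: mult_ac)
  then have "4 * (real (k + 1) * ?b) \<le> real (k + 2) * ?c"
    by (rule mult_left_le_imp_le) simp
  moreover have "4 ^ Suc k * leaf_count m \<le> 4 * (real (k + 1) * ?b)" using Suc by simp
  ultimately show ?case by simp
qed simp

lemma catalan_lower: "4 ^ n \<le> real (n + 1) ^ 2 * catalan n"
  using leaf_count_growth[of n 0] by (simp add: leaf_count_def power2_eq_square)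

text \<open>Telescopes by
  \<open>2 * catalan i = 4 * leaf_count i - leaf_count (i + 1)\<close>.\<close>

lemma sum_catalan: "(\<Sum>i\<le>n. catalan i / 4 ^ i) = 2 - 2 * leaf_count (Suc n) / 4 ^ Suc n"
proof (induction n)
  case 0
  show ?case using leaf_count_Suc[of 0] by simp
next
  case (Suc n)
  have "real (n + 2) * leaf_count (Suc (Suc n)) = real (4 * n + 6) * leaf_count (Suc n)"
    using leaf_count_Suc[of "Suc n"] by (simp add: algebra_simps)
  also have "\<dots> = real (n + 2) * (4 * leaf_count (Suc n) - 2 * catalan (Suc n))"
    by (simp add: leaf_count_def algebra_simps)
  finally have *: "leaf_count (Suc (Suc n)) = 4 * leaf_count (Suc n) - 2 * catalan (Suc n)"
    by (simp only: mult_cancel_left) simp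
  show ?case unfolding sum.atMost_Suc Suc * by (simp add: field_simps)
qed

text \<open>The gap \<open>2 / (n + 2)\<close> below 2 later pays for evaluating slightly beyond
  1/4.\<close>

lemma sum_catalan_le: "(\<Sum>i\<le>n. catalan i / 4 ^ i) \<le> 2 * (1 - 1 / real (n + 2))"
  using leaf_count_growth[of "Suc n" 0] unfolding sum_catalan by (simp add: field_simps)

text \<open>A marked leaf lies in the left or the right subtree, two symmetric cases; algebraically
  \<open>n + 2 = (i + 1) + (n - i + 1)\<close>.\<close>

lemma leaf_count_conv: "leaf_count (Suc n) = 2 * (\<Sum>i\<le>n. catalan (n - i) * leaf_count i)"
proof -
  have "leaf_count (Suc n) = (\<Sum>i\<le>n. real (n + 2) * (catalan i * catalan (n - i)))"
    by (simp add: leaf_count_def catalan_Suc sum_distrib_left)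
  also have "\<dots> = (\<Sum>i\<le>n. catalan (n - i) * leaf_count i + catalan i * leaf_count (n - i))"
    by (intro sum.cong) (auto simp: leaf_count_def of_nat_diff algebra_simps)
  also have "\<dots> = (\<Sum>i\<le>n. catalan (n - i) * leaf_count i) + (\<Sum>i\<le>n. catalan i * leaf_count (n - i))"
    by (simp add: sum.distrib)
  finally show ?thesis
    using sum_antidiagonal_swap[of "\<lambda>i j. catalan i * leaf_count j" n] by simp
qed

section \<open>The number of chain subtrees\<close>

text \<open>Nodes are counted rather than elements of \<open>subtrees\<close>, so the totals over
  \<open>trees n\<close> satisfy a linear recurrence.\<close>

fun chain_count :: "nat \<Rightarrow> tree \<Rightarrow> nat" where
  "chain_count k Tip = 0"
| "chain_count k (Node l r) =
    of_bool (chain (Node l r) \<and> size (Node l r) = k) + chain_count k l + chain_count k r"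

text \<open>Each node except the lowest chooses the side of its only child.\<close>

lemma card_chains: "card {t \<in> trees (Suc n). chain t} = 2 ^ n"
proof (induction n)
  case 0
  have "{t \<in> trees (Suc 0). chain t} = {Node Tip Tip}"
    by (auto simp: trees_Suc trees_0)
  then show ?case by simp
next
  case (Suc n)
  let ?X = "{t \<in> trees (Suc n). chain t}"
  have eq: "{t \<in> trees (Suc (Suc n)). chain t} = Node Tip ` ?X \<union> (\<lambda>t. Node t Tip) ` ?X"
  proof (intro equalityI subsetI)
    fix t assume "t \<in> {t \<in> trees (Suc (Suc n)). chain t}"
    then show "t \<in> Node Tip ` ?X \<union> (\<lambda>t. Node t Tip) ` ?X"
      by (cases t) (auto simp: trees_def)
  qed (auto simp: trees_def)
  have fin: "finite ?X" by simp
  have "card (Node Tip ` ?X \<union> (\<lambda>t. Node t Tip) ` ?X) = card (Node Tip ` ?X) + card ((\<lambda>t. Node t Tip) ` ?X)"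
    by (intro card_Un_disjoint finite_imageI) (auto simp: fin, auto simp: trees_def)
  also have "\<dots> = 2 * card ?X"
    by (simp add: card_image inj_on_def)
  finally show ?case using Suc eq by simp
qed

lemma sum_chain_indicator:
  assumes "k \<ge> 1"
  shows "(\<Sum>t\<in>trees n. of_bool (chain t \<and> size t = k)) = (of_bool (n = k) * 2 ^ (k - 1) :: real)"
proof (cases "n = k")
  case True
  obtain m where m: "k = Suc m" using assms by (cases k) auto
  have "(\<Sum>t\<in>trees n. of_bool (chain t \<and> size t = k)) = (\<Sum>t\<in>trees n. of_bool (chain t) :: real)"
    using True by (intro sum.cong) (auto simp: trees_def)
  also have "\<dots> = real (card {t \<in> trees n. chain t})"
    by (simp add: sum.If_cases Collect_conj_eq Int_commute of_bool_def)
  finally show ?thesis using True m card_chains[of m] by simp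
next
  case False
  then show ?thesis by (auto simp: trees_def)
qed

text \<open>A counted chain is the whole tree or lies in one of the two subtrees while the other is
  arbitrary; symmetry gives the factor 2.\<close>

lemma sum_chain_count_rec:
  assumes "k \<ge> 1"
  shows "(\<Sum>t\<in>trees (Suc n). real (chain_count k t)) = of_bool (Suc n = k) * 2 ^ (k - 1)
    + 2 * (\<Sum>i\<le>n. catalan (n - i) * (\<Sum>t\<in>trees i. real (chain_count k t)))"
proof -
  let ?T = "\<lambda>n. \<Sum>t\<in>trees n. real (chain_count k t)"
  let ?I = "\<lambda>t. of_bool (chain t \<and> size t = k) :: real"
  have "?T (Suc n) = (\<Sum>i\<le>n. \<Sum>l\<in>trees i. \<Sum>r\<in>trees (n - i).
      ?I (Node l r) + (real (chain_count k l) + real (chain_count k r)))"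
    unfolding sum_trees_Suc by (intro sum.cong refl) simp
  also have "\<dots> = (\<Sum>i\<le>n. \<Sum>l\<in>trees i. \<Sum>r\<in>trees (n - i). ?I (Node l r))
      + (\<Sum>i\<le>n. catalan (n - i) * ?T i + catalan i * ?T (n - i))"
    by (simp add: sum.distrib catalan_def sum_distrib_left del: chain.simps)
  also have "(\<Sum>i\<le>n. \<Sum>l\<in>trees i. \<Sum>r\<in>trees (n - i). ?I (Node l r)) = of_bool (Suc n = k) * 2 ^ (k - 1)"
    using sum_chain_indicator[OF assms, of "Suc n"] unfolding sum_trees_Suc by simp
  finally show ?thesis
    using sum_antidiagonal_swap[of "\<lambda>i j. catalan i * ?T j" n] by (simp add: sum.distrib)
qed

lemma chain_count_eq_0: "size t < k \<Longrightarrow> chain_count k t = 0"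
  by (induction t) auto

lemma sum_chain_count_small: "n < k \<Longrightarrow> (\<Sum>t\<in>trees n. real (chain_count k t)) = 0"
  by (auto simp: trees_def chain_count_eq_0)

text \<open>
  Contracting the marked chain to a leaf turns a tree with a marked chain of size \<open>k\<close> into a tree
  with \<open>m\<close> nodes and a marked leaf.
\<close>

lemma sum_chain_count:
  assumes "k \<ge> 1"
  shows "(\<Sum>t\<in>trees (k + m). real (chain_count k t)) = 2 ^ (k - 1) * leaf_count m"
proof (induction m rule: less_induct)
  case (less m)
  let ?T = "\<lambda>n. \<Sum>t\<in>trees n. real (chain_count k t)"
  obtain k' where k': "k = Suc k'" using assms by (cases k) auto
  show ?case
  proof (cases m)
    case 0
    have "?T (Suc k') = 2 ^ (k - 1)"
      using sum_chain_count_rec[OF assms, of k'] k'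
      by (simp add: sum_chain_count_small)
    then show ?thesis using 0 k' by simp
  next
    case (Suc m')
    have "?T (k + m) = 2 * (\<Sum>i\<le>k + m'. catalan (k + m' - i) * ?T i)"
      using sum_chain_count_rec[OF assms, of "k + m'"] Suc by simp
    \<comment> \<open>Trees with fewer than \<open>k\<close> nodes contribute nothing, so a shift by
      \<open>k\<close> turns the recurrence into that of \<open>leaf_count_conv\<close>.\<close>
    also have "(\<Sum>i\<le>k + m'. catalan (k + m' - i) * ?T i) = (\<Sum>i=k..k + m'. catalan (k + m' - i) * ?T i)"
      by (intro sum.mono_neutral_right) (auto simp: sum_chain_count_small not_le)
    also have "\<dots> = (\<Sum>j\<le>m'. catalan (m' - j) * ?T (k + j))"
      by (rule sum.reindex_bij_witness[of _ "\<lambda>j. k + j" "\<lambda>i. i - k"]) (auto simp: add.commute)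
    also have "\<dots> = (\<Sum>j\<le>m'. 2 ^ (k - 1) * (catalan (m' - j) * leaf_count j))"
      using less Suc by (intro sum.cong) auto
    also have "\<dots> = 2 ^ (k - 1) * (\<Sum>j\<le>m'. catalan (m' - j) * leaf_count j)"
      by (rule sum_distrib_left[symmetric])
    finally show ?thesis
      using Suc leaf_count_conv[of m'] by simp
  qed
qed

lemma sum_chain_count_le:
  assumes "k \<ge> 1" "k \<le> n"
  shows "(\<Sum>t\<in>trees n. real (chain_count k t)) \<le> catalan n * (real (n + 1) / 2 * (real (k + 1) / 2 ^ k))"
proof -
  obtain m where m: "n = k + m" using assms(2) le_Suc_ex by blast
  have "(\<Sum>t\<in>trees n. real (chain_count k t)) = 2 ^ k / 2 * leaf_count m"
    using sum_chain_count[OF assms(1), of m] assms(1) m by (simp add: power_diff)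
  also have "\<dots> = (4 ^ k * leaf_count m) / (2 * 2 ^ k)"
    by (simp add: field_simps flip: power_mult_distrib)
  also have "\<dots> \<le> (real (k + 1) * leaf_count (m + k)) / (2 * 2 ^ k)"
    by (intro divide_right_mono leaf_count_growth) auto
  also have "\<dots> = catalan n * (real (n + 1) / 2 * (real (k + 1) / 2 ^ k))"
    by (simp add: leaf_count_def m field_simps)
  finally show ?thesis .
qed

section \<open>The largest chain in terms of chain counts\<close>

lemma finite_subtrees [simp]: "finite (subtrees t)"
  by (induction t) auto

lemma chain_subtree_exists: "t \<noteq> Tip \<Longrightarrow> \<exists>u\<in>subtrees t. chain u"
  by (induction t) (metis Un_iff chain.simps insertCI subtrees.simps(2) tree.exhaust)+

lemma size_subtree_le: "u \<in> subtrees t \<Longrightarrow> size u \<le> size t"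
  by (induction t) auto

lemma chain_count_subtree_le: "u \<in> subtrees t \<Longrightarrow> chain_count k u \<le> chain_count k t"
  by (induction t) (auto simp: le_SucI trans_le_add1 trans_le_add2)

lemma chain_count_pos_imp: "chain_count k t > 0 \<Longrightarrow> \<exists>u\<in>subtrees t. chain u \<and> size u = k"
  by (induction t) (auto split: if_splits)

lemma chain_count_chain_pos: "chain t \<Longrightarrow> 1 \<le> k \<Longrightarrow> k \<le> size t \<Longrightarrow> chain_count k t > 0"
proof (induction t)
  case (Node l r)
  show ?case
  proof (cases "k = size (Node l r)")
    case True
    then show ?thesis using Node.prems by simp
  next
    case False
    then have "k \<le> size l \<and> r = Tip \<and> chain l \<or> k \<le> size r \<and> l = Tip \<and> chain r"
      using Node.prems by auto
    then show ?thesis using Node by auto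
  qed
qed simp

text \<open>A chain contains chains of all smaller positive sizes, so one of size at least
  \<open>k\<close> exists iff one of size exactly \<open>k\<close> does.\<close>

lemma max_chain_ge_iff:
  assumes "t \<noteq> Tip" "k \<ge> 1"
  shows "k \<le> max_chain t \<longleftrightarrow> chain_count k t > 0"
proof -
  let ?S = "size ` {u \<in> subtrees t. chain u}"
  have S: "finite ?S" "?S \<noteq> {}" using chain_subtree_exists[OF assms(1)] by auto
  have "k \<le> max_chain t \<longleftrightarrow> (\<exists>u\<in>subtrees t. chain u \<and> k \<le> size u)"
    unfolding max_chain_def Max_ge_iff[OF S] by auto
  also have "\<dots> \<longleftrightarrow> chain_count k t > 0"
    using chain_count_pos_imp chain_count_chain_pos[OF _ assms(2)] chain_count_subtree_le
    by (metis le_refl less_le_trans)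
  finally show ?thesis .
qed

lemma max_chain_le_size:
  assumes "t \<noteq> Tip"
  shows "max_chain t \<le> size t"
  using chain_subtree_exists[OF assms] size_subtree_le
  unfolding max_chain_def by (subst Max_le_iff) auto

text \<open>Every size from \<open>K + 1\<close> up to the maximum contributes at least 1 to the
  sum.\<close>

lemma max_chain_le_sum_chain_count:
  assumes "t \<in> trees n" "n \<ge> 1"
  shows "max_chain t \<le> K + (\<Sum>k\<in>{K<..n}. chain_count k t)"
proof -
  have t: "t \<noteq> Tip" "size t = n" using assms by (auto simp: trees_def)
  have "max_chain t \<le> K + (\<Sum>k\<in>{K<..max_chain t}. 1)" by simp
  also have "(\<Sum>k\<in>{K<..max_chain t}. 1) \<le> (\<Sum>k\<in>{K<..max_chain t}. chain_count k t)"
    using max_chain_ge_iff[OF t(1)] by (intro sum_mono) (auto simp: Suc_le_eq)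
  also have "\<dots> \<le> (\<Sum>k\<in>{K<..n}. chain_count k t)"
    using max_chain_le_size[OF t(1)] t(2) by (intro sum_mono2) auto
  finally show ?thesis by simp
qed

section \<open>Trees without a chain subtree of given size\<close>

definition no_chain_count :: "nat \<Rightarrow> nat \<Rightarrow> real" where
  "no_chain_count k n = (\<Sum>t\<in>trees n. of_bool (chain_count (Suc k) t = 0))"

lemma no_chain_count_nonneg: "no_chain_count k n \<ge> 0"
  by (simp add: no_chain_count_def sum_nonneg)

lemma no_chain_count_le: "no_chain_count k n \<le> catalan n"
proof -
  have "no_chain_count k n \<le> (\<Sum>t\<in>trees n. 1)"
    unfolding no_chain_count_def by (intro sum_mono) simp
  then show ?thesis by (simp add: catalan_def)
qed

lemma no_chain_count_0 [simp]: "no_chain_count k 0 = 1"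
  by (simp add: no_chain_count_def trees_0)

text \<open>Both children of a counted tree are counted as well. The \<open>2 ^ k\<close> chains of
  size \<open>k + 1\<close> also have such children without being counted themselves, which yields
  the extra term at \<open>n = k\<close>.\<close>

lemma no_chain_count_Suc:
  "no_chain_count k (Suc n) + of_bool (n = k) * 2 ^ k \<le> (\<Sum>i\<le>n. no_chain_count k i * no_chain_count k (n - i))"
proof -
  let ?z = "\<lambda>t. of_bool (chain_count (Suc k) t = 0) :: real"
  let ?I = "\<lambda>t. of_bool (chain t \<and> size t = Suc k) :: real"
  have "no_chain_count k (Suc n) + of_bool (n = k) * 2 ^ k = (\<Sum>t\<in>trees (Suc n). ?z t + ?I t)"
    using sum_chain_indicator[of "Suc k" "Suc n"] unfolding no_chain_count_def sum.distrib by simp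
  also have "\<dots> = (\<Sum>i\<le>n. \<Sum>l\<in>trees i. \<Sum>r\<in>trees (n - i). ?z (Node l r) + ?I (Node l r))"
    by (rule sum_trees_Suc)
  also have "\<dots> \<le> (\<Sum>i\<le>n. \<Sum>l\<in>trees i. \<Sum>r\<in>trees (n - i). ?z l * ?z r)"
    by (intro sum_mono) (auto simp: chain_count_eq_0)
  finally show ?thesis
    unfolding no_chain_count_def sum_product .
qed

lemma Bernoulli_reciprocal:
  fixes d :: real
  assumes "0 \<le> d" "d \<le> 1"
  shows "(1 + d) ^ n * (1 - real n * d) \<le> 1"
proof -
  have "(1 + d) ^ n * (1 - real n * d) \<le> (1 + d) ^ n * (1 - d) ^ n"
    using Bernoulli_inequality[of "- d" n] assms by (intro mult_left_mono) auto
  also have "\<dots> = (1 - d * d) ^ n" by (simp add: algebra_simps flip: power_mult_distrib)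
  also have "\<dots> \<le> 1" using assms by (intro power_le_one) (auto simp: mult_le_one)
  finally show ?thesis .
qed

text \<open>For \<open>d = 1 / 2 ^ (k + 2)\<close> this says that \<open>(k + 1) * d\<close> is at
  most \<open>1 / (k + 2)\<close>, the relative gap in \<open>sum_catalan_le\<close>.\<close>

lemma quadratic_le_power2: "real (k + 1) * real (k + 2) \<le> 2 ^ (k + 2)"
proof (induction k)
  case (Suc k)
  show ?case
  proof (cases "k = 0")
    case False
    then have "real k \<ge> 1" by simp
    then have "real (Suc k + 2) \<le> 2 * real (k + 1)" by simp
    then have "real (Suc k + 1) * real (Suc k + 2) \<le> real (k + 2) * (2 * real (k + 1))"
      by (intro mult_mono) auto
    also have "\<dots> = 2 * (real (k + 1) * real (k + 2))" by (simp only: mult_ac)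
    also have "\<dots> \<le> 2 * 2 ^ (k + 2)" using Suc by (intro mult_left_mono) auto
    finally show ?thesis by simp
  qed simp
qed simp

text \<open>The left side ranges over the triangle \<open>i + j \<le> N\<close>, which lies in the
  square on the right.\<close>

lemma sum_convolution_le_square:
  fixes f :: "nat \<Rightarrow> real"
  assumes "\<And>i. f i \<ge> 0"
  shows "(\<Sum>n\<le>N. \<Sum>i\<le>n. f i * f (n - i)) \<le> (\<Sum>i\<le>N. f i) ^ 2"
proof -
  have "(\<Sum>n\<le>N. \<Sum>i\<le>n. f i * f (n - i)) = (\<Sum>(i, j)\<in>{(i, j). i + j \<le> N}. f i * f j)"
    by (simp add: sum.triangle_reindex_eq)
  also have "\<dots> \<le> (\<Sum>(i, j)\<in>{..N} \<times> {..N}. f i * f j)"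
    using assms by (intro sum_mono2) auto
  finally show ?thesis by (simp add: power2_eq_square sum_product sum.cartesian_product)
qed

text \<open>
  At \<open>x = (1 + d) / 4\<close> the value \<open>y = 1 / (2 x)\<close> satisfies
  \<open>1 + x y\<^sup>2 - 2 ^ k x ^ (k + 1) \<le> y\<close>, so it bounds all partial sums of the generating function
  from the point on where the correction term has entered.
\<close>

lemma sum_no_chain_count_le:
  fixes k :: nat
  defines "d \<equiv> 1 / 2 ^ (k + 2) :: real"
  defines "x \<equiv> (1 + d) / 4"
  shows "(\<Sum>i\<le>N. no_chain_count k i * x ^ i) \<le> 1 / (2 * x)"
proof (induction N)
  have d: "0 < d" "d \<le> 1" by (auto simp: d_def divide_le_eq_1 simp del: power_Suc power_add intro: one_le_power)
  have x: "0 < x" using d by (simp add: x_def)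
  \<comment> \<open>Up to index \<open>k\<close> the correction term has not entered. There the
    Catalan partial sums stay far enough below 2 to absorb the factor
    \<open>(1 + d) ^ k\<close>.\<close>
  have small: "(\<Sum>i\<le>N. no_chain_count k i * x ^ i) \<le> 1 / (2 * x)" if "N \<le> k" for N
  proof -
    have "(\<Sum>i\<le>N. no_chain_count k i * x ^ i) \<le> (\<Sum>i\<le>k. no_chain_count k i * x ^ i)"
      using that x no_chain_count_nonneg by (intro sum_mono2) auto
    also have "\<dots> \<le> (\<Sum>i\<le>k. (1 + d) ^ k * (catalan i / 4 ^ i))"
    proof (intro sum_mono)
      fix i assume "i \<in> {..k}"
      then have "(1 + d) ^ i \<le> (1 + d) ^ k" using d by (intro power_increasing) auto
      then have "catalan i / 4 ^ i * (1 + d) ^ i \<le> catalan i / 4 ^ i * (1 + d) ^ k"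
        using catalan_pos[of i] by (intro mult_left_mono) auto
      moreover have "no_chain_count k i * x ^ i \<le> catalan i * x ^ i"
        using x by (intro mult_right_mono no_chain_count_le) auto
      ultimately show "no_chain_count k i * x ^ i \<le> (1 + d) ^ k * (catalan i / 4 ^ i)"
        by (simp add: x_def power_divide mult_ac)
    qed
    also have "\<dots> \<le> (1 + d) ^ k * (2 * (1 - 1 / real (k + 2)))"
      unfolding sum_distrib_left[symmetric] using d by (intro mult_left_mono sum_catalan_le) auto
    also have "\<dots> \<le> (1 + d) ^ k * (2 * (1 - real (k + 1) * d))"
    proof -
      have "real (k + 1) * d \<le> 1 / real (k + 2)"
        using quadratic_le_power2[of k] by (simp add: d_def field_simps)
      then show ?thesis using d by (intro mult_left_mono) auto
    qed
    \<comment> \<open>One more factor \<open>1 + d\<close> matches the exponent in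
      \<open>Bernoulli_reciprocal\<close> and leaves
      \<open>2 / (1 + d) = 1 / (2 * x)\<close>.\<close>
    also have "\<dots> = 2 / (1 + d) * ((1 + d) ^ (k + 1) * (1 - real (k + 1) * d))"
      using d by (simp add: power_add)
    also have "\<dots> \<le> 2 / (1 + d) * 1"
      using Bernoulli_reciprocal[of d "k + 1"] d by (intro mult_left_mono) auto
    also have "\<dots> = 1 / (2 * x)" using d by (simp add: x_def field_simps)
    finally show ?thesis .
  qed
  case 0
  show ?case by (rule small) simp
  case (Suc N)
  show ?case
  proof (cases "Suc N \<le> k")
    case False
    let ?f = "\<lambda>i. no_chain_count k i * x ^ i"
    have "(\<Sum>i\<le>Suc N. ?f i) = 1 + (\<Sum>n\<le>N. ?f (Suc n))"
      by (subst sum.atMost_Suc_shift) simp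
    also have "(\<Sum>n\<le>N. ?f (Suc n)) \<le>
      (\<Sum>n\<le>N. x * (\<Sum>i\<le>n. ?f i * ?f (n - i)) - of_bool (n = k) * (2 ^ k * x ^ (k + 1)))"
    proof (intro sum_mono)
      fix n
      have "no_chain_count k (Suc n) * x ^ Suc n
          \<le> ((\<Sum>i\<le>n. no_chain_count k i * no_chain_count k (n - i)) - of_bool (n = k) * 2 ^ k) * x ^ Suc n"
        using no_chain_count_Suc[of k n] x by (intro mult_right_mono) auto
      also have "\<dots> = x * (\<Sum>i\<le>n. no_chain_count k i * no_chain_count k (n - i) * x ^ n) - of_bool (n = k) * (2 ^ k * x ^ (k + 1))"
        by (simp add: power_add algebra_simps sum_distrib_left sum_distrib_right)
      also have "(\<Sum>i\<le>n. no_chain_count k i * no_chain_count k (n - i) * x ^ n) = (\<Sum>i\<le>n. ?f i * ?f (n - i))"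
        by (intro sum.cong) (auto simp: mult_ac simp flip: power_add)
      finally show "?f (Suc n) \<le> x * (\<Sum>i\<le>n. ?f i * ?f (n - i)) - of_bool (n = k) * (2 ^ k * x ^ (k + 1))" .
    qed
    also have "\<dots> = x * (\<Sum>n\<le>N. \<Sum>i\<le>n. ?f i * ?f (n - i)) - 2 ^ k * x ^ (k + 1)"
    proof -
      \<comment> \<open>Here \<open>k \<le> N\<close>, so the correction is subtracted exactly
        once.\<close>
      have "(\<Sum>n\<le>N. of_bool (n = k) * (2 ^ k * x ^ (k + 1))) = 2 ^ k * x ^ (k + 1)"
        using False by (subst sum.mono_neutral_right[of _ "{k}"]) auto
      then show ?thesis by (simp only: sum_subtractf sum_distrib_left)
    qed
    also have "\<dots> \<le> x * (1 / (2 * x)) ^ 2 - 2 ^ k * x ^ (k + 1)"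
    proof -
      have "(\<Sum>n\<le>N. \<Sum>i\<le>n. ?f i * ?f (n - i)) \<le> (\<Sum>i\<le>N. ?f i) ^ 2"
        using x no_chain_count_nonneg by (intro sum_convolution_le_square) auto
      also have "\<dots> \<le> (1 / (2 * x)) ^ 2"
        using Suc x no_chain_count_nonneg by (intro power_mono sum_nonneg) auto
      finally show ?thesis using x by (intro diff_right_mono mult_left_mono) auto
    qed
    finally have "(\<Sum>i\<le>Suc N. ?f i) \<le> 1 + x * (1 / (2 * x)) ^ 2 - 2 ^ k * x ^ (k + 1)" by simp
    also have "\<dots> \<le> 1 / (2 * x)"
    proof -
      \<comment> \<open>This choice of \<open>d\<close> gives
        \<open>4 * x - 1 = d \<le> (2 * x) ^ (k + 2)\<close>. Division by \<open>4 * x\<close>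
        yields \<open>1 - 1 / (4 * x) \<le> 2 ^ k * x ^ (k + 1)\<close>, exactly the inequality that
        makes \<open>1 / (2 * x)\<close> reproduce itself.\<close>
      have d4: "2 ^ (k + 2) / 4 ^ (k + 2) = d"
        unfolding d_def power_divide[symmetric] power_one_over[symmetric] by simp
      have "d * 1 \<le> d * (1 + d) ^ (k + 2)" using d by (intro mult_left_mono one_le_power) auto
      also have "\<dots> = 2 ^ (k + 2) / 4 ^ (k + 2) * (1 + d) ^ (k + 2)"
        by (simp only: d4)
      also have "\<dots> = 2 ^ (k + 2) * x ^ (k + 2)"
        by (simp add: x_def power_divide)
      also have "\<dots> = 4 * x * (2 ^ k * x ^ (k + 1))"
        by (simp add: power_add power2_eq_square)
      finally have "d \<le> 4 * x * (2 ^ k * x ^ (k + 1))" by (simp only: mult_1_right)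
      moreover have "d = 4 * x - 1" by (simp add: x_def field_simps)
      ultimately have "4 * x - 1 \<le> 4 * x * (2 ^ k * x ^ (k + 1))" by (simp only:)
      then have "(4 * x - 1) / (4 * x) \<le> 2 ^ k * x ^ (k + 1)"
        using x by (simp add: pos_divide_le_eq mult.commute)
      moreover have "(4 * x - 1) / (4 * x) = 1 + x * (1 / (2 * x)) ^ 2 - 1 / (2 * x)"
        using x by (simp add: field_simps power2_eq_square)
      ultimately show ?thesis by linarith
    qed
    finally show ?thesis .
  qed (rule small)
qed

text \<open>A single term of the nonnegative series is at most \<open>1 / (2 * x) \<le> 2\<close>.
  In \<open>x ^ n\<close> the factor \<open>(1 + d) ^ n\<close> gives the exponential decay, and
  \<open>4 ^ n\<close> is at most \<open>catalan n\<close> up to a quadratic factor.\<close>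

lemma no_chain_count_bound:
  "no_chain_count k n \<le> catalan n * (2 * real (n + 1) ^ 2 * exp (- (real n / 2 ^ (k + 3))))"
proof -
  define d where "d = (1 / 2 ^ (k + 2) :: real)"
  define x where "x = (1 + d) / 4"
  have d: "0 < d" "d \<le> 1" by (auto simp: d_def divide_le_eq_1 simp del: power_Suc power_add intro: one_le_power)
  have x: "0 < x" using d by (simp add: x_def)
  have "no_chain_count k n * x ^ n \<le> (\<Sum>i\<le>n. no_chain_count k i * x ^ i)"
    using no_chain_count_nonneg x by (intro member_le_sum) auto
  also have "\<dots> \<le> 1 / (2 * x)"
    using sum_no_chain_count_le[of k n] unfolding x_def d_def .
  also have "\<dots> \<le> 2" using d by (simp add: x_def field_simps)
  finally have *: "no_chain_count k n * x ^ n \<le> 2" .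
  \<comment> \<open>From \<open>exp y \<le> 1 + y + y * y\<close> and \<open>y * y \<le> y\<close>
    at \<open>y = d / 2\<close>.\<close>
  have "exp (d / 2) \<le> 1 + d"
    using exp_bound[of "d / 2"] d power_decreasing[of 1 2 "d / 2"] by simp
  then have "exp (d / 2) ^ n \<le> (1 + d) ^ n" by (intro power_mono) auto
  then have "exp (real n / 2 ^ (k + 3)) \<le> (1 + d) ^ n"
    by (simp add: d_def power_add mult.commute flip: exp_of_nat_mult)
  then have "no_chain_count k n * exp (real n / 2 ^ (k + 3)) \<le> no_chain_count k n * (1 + d) ^ n"
    by (intro mult_left_mono no_chain_count_nonneg)
  also have "\<dots> = no_chain_count k n * x ^ n * 4 ^ n"
    by (simp add: x_def power_divide)
  also have "\<dots> \<le> 2 * (real (n + 1) ^ 2 * catalan n)"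
    using * catalan_lower[of n] by (intro mult_mono) auto
  finally show ?thesis by (simp add: exp_minus field_simps)
qed

section \<open>The mean size of the largest chain subtree\<close>

definition mean_max_chain :: "nat \<Rightarrow> real" where
  "mean_max_chain n = (\<Sum>t\<in>trees n. real (max_chain t)) / catalan n"

text \<open>Telescopes by
  \<open>(k + 1) / 2 ^ k = (k + 2) / 2 ^ (k - 1) - (k + 3) / 2 ^ k\<close>.\<close>

lemma sum_geometric_linear:
  "K \<le> n \<Longrightarrow> (\<Sum>k\<in>{K<..n}. real (k + 1) / 2 ^ k) = real (K + 3) / 2 ^ K - real (n + 3) / 2 ^ n"
proof (induction n)
  case (Suc n)
  show ?case
  proof (cases "K = Suc n")
    case False
    then have "{K<..Suc n} = insert (Suc n) {K<..n}" using Suc.prems by auto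
    moreover have "real (n + 3) / 2 ^ n = real (n + 2) / 2 ^ Suc n + real (Suc n + 3) / 2 ^ Suc n"
      by (simp add: field_simps)
    ultimately show ?thesis using Suc False by simp
  qed simp
qed auto

text \<open>The mean excess over \<open>K\<close> is at most the mean number of chains larger than
  \<open>K\<close>.\<close>

lemma mean_max_chain_upper:
  assumes "n \<ge> 1"
  shows "mean_max_chain n \<le> real K + real (n + 1) * real (K + 3) / 2 ^ (K + 1)"
proof -
  have "(\<Sum>t\<in>trees n. real (max_chain t))
      \<le> (\<Sum>t\<in>trees n. real K + (\<Sum>k\<in>{K<..n}. real (chain_count k t)))"
    using max_chain_le_sum_chain_count[OF _ assms, of _ K] by (intro sum_mono) (metis of_nat_add of_nat_le_iff of_nat_sum)
  also have "\<dots> = catalan n * real K + (\<Sum>k\<in>{K<..n}. \<Sum>t\<in>trees n. real (chain_count k t))"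
    by (simp add: sum.distrib catalan_def) (rule sum.swap)
  also have "\<dots> \<le> catalan n * real K
      + (\<Sum>k\<in>{K<..n}. catalan n * (real (n + 1) / 2 * (real (k + 1) / 2 ^ k)))"
    by (intro add_left_mono sum_mono sum_chain_count_le) auto
  also have "\<dots> = catalan n * (real K + real (n + 1) / 2 * (\<Sum>k\<in>{K<..n}. real (k + 1) / 2 ^ k))"
    by (simp add: sum_distrib_left algebra_simps)
  also have "\<dots> \<le> catalan n * (real K + real (n + 1) / 2 * (real (K + 3) / 2 ^ K))"
  proof -
    have "(\<Sum>k\<in>{K<..n}. real (k + 1) / 2 ^ k) \<le> real (K + 3) / 2 ^ K"
      by (cases "K \<le> n") (use sum_geometric_linear[of K n] in auto)
    then show ?thesis using catalan_pos[of n] by (intro mult_left_mono add_left_mono) auto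
  qed
  finally show ?thesis
    using catalan_pos[of n] by (simp add: mean_max_chain_def field_simps power_add)
qed

text \<open>Outside the trees counted by \<open>no_chain_count k\<close> the maximum is at least
  \<open>k + 1\<close>; on them it is bounded below by 0.\<close>

lemma mean_max_chain_lower:
  assumes "n \<ge> 1"
  shows "mean_max_chain n \<ge> real (k + 1) * (1 - 2 * real (n + 1) ^ 2 * exp (- (real n / 2 ^ (k + 3))))"
proof -
  let ?e = "2 * real (n + 1) ^ 2 * exp (- (real n / 2 ^ (k + 3)))"
  have "catalan n * (real (k + 1) * (1 - ?e)) = real (k + 1) * (catalan n - catalan n * ?e)"
    by (simp add: algebra_simps)
  also have "\<dots> \<le> real (k + 1) * (catalan n - no_chain_count k n)"
    by (intro mult_left_mono diff_left_mono no_chain_count_bound) auto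
  also have "\<dots> = (\<Sum>t\<in>trees n. real (k + 1) * (1 - of_bool (chain_count (Suc k) t = 0)))"
    by (simp add: no_chain_count_def catalan_def sum_subtractf flip: sum_distrib_left)
  also have "\<dots> \<le> (\<Sum>t\<in>trees n. real (max_chain t))"
  proof (intro sum_mono)
    fix t assume "t \<in> trees n"
    then have "t \<noteq> Tip" using assms by (auto simp: trees_def)
    then show "real (k + 1) * (1 - of_bool (chain_count (Suc k) t = 0)) \<le> real (max_chain t)"
      using max_chain_ge_iff[of t "Suc k"] by (cases "chain_count (Suc k) t = 0") auto
  qed
  finally show ?thesis
    using catalan_pos[of n] by (simp add: mean_max_chain_def field_simps)
qed

lemma mean_max_chain_eventually_le:
  "eventually (\<lambda>n. mean_max_chain n \<le> (log 2 n + log 2 (ln n) + 1)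
     + (n + 1) * (log 2 n + log 2 (ln n) + 4) / (2 * n * ln n)) sequentially"
proof -
  have "eventually (\<lambda>n. real n * ln (real n) \<ge> 1 \<and> ln (real n) > 0 \<and> n \<ge> 1) sequentially"
    by (intro eventually_conj; real_asymp)
  then show ?thesis
  proof eventually_elim
    case (elim n)
    \<comment> \<open>The least \<open>K\<close> with \<open>n * ln n \<le> 2 ^ K\<close>: the error
      term stays bounded, while \<open>K\<close> exceeds \<open>log 2 n\<close> by at most
      \<open>log 2 (ln n) + 1\<close>.\<close>
    define K where "K = nat \<lceil>log 2 (real n * ln (real n))\<rceil>"
    have pos: "log 2 (real n * ln (real n)) \<ge> 0" using elim by simp
    have eq: "log 2 (real n * ln (real n)) = log 2 n + log 2 (ln n)"
      using elim by (subst log_mult) auto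
    have K_le: "real K \<le> log 2 n + log 2 (ln n) + 1"
      unfolding K_def eq[symmetric] using pos by linarith
    have "log 2 (real n * ln (real n)) \<le> real K"
      unfolding K_def by linarith
    then have "real n * ln (real n) \<le> 2 powr real K"
      using elim by (simp add: log_le_iff)
    then have two_K: "real n * ln (real n) \<le> 2 ^ K" by (simp add: powr_realpow)
    have "mean_max_chain n \<le> real K + real (n + 1) * real (K + 3) / 2 ^ (K + 1)"
      using elim by (intro mean_max_chain_upper) auto
    also have "real (n + 1) * real (K + 3) / 2 ^ (K + 1)
        \<le> (n + 1) * (log 2 n + log 2 (ln n) + 4) / (2 * n * ln n)"
      using elim K_le two_K by (intro frac_le mult_mono) (auto simp: power_add)
    finally show ?case using K_le by simp
  qed
qed

lemma mean_max_chain_eventually_ge: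
  "eventually (\<lambda>n. mean_max_chain n
     \<ge> log 2 (n / (24 * ln n)) * (1 - 2 * (real n + 1) ^ 2 / real n ^ 3)) sequentially"
proof -
  \<comment> \<open>The last condition keeps the factor next to the logarithm nonnegative, so that
    the products can be compared.\<close>
  have "eventually (\<lambda>n. real n / (24 * ln (real n)) \<ge> 1 \<and> ln (real n) > 0 \<and> n \<ge> 1
      \<and> 2 * (real n + 1) ^ 2 / real n ^ 3 \<le> 1) sequentially"
    by (intro eventually_conj; real_asymp)
  then show ?thesis
  proof eventually_elim
    case (elim n)
    let ?q = "real n / (24 * ln (real n))"
    \<comment> \<open>As \<open>24 = 3 * 8\<close>, this gives
      \<open>n / 2 ^ (k + 3) \<ge> 3 * ln n\<close>, and the resulting \<open>1 / n ^ 3\<close>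
      beats the quadratic factor. Rounding down costs nothing, because the lower bound carries
      \<open>k + 1\<close>.\<close>
    define k where "k = nat \<lfloor>log 2 ?q\<rfloor>"
    have "log 2 ?q \<ge> 0" using elim by simp
    then have k: "real k \<le> log 2 ?q" "log 2 ?q \<le> real (k + 1)" unfolding k_def by linarith+
    then have "2 powr real k \<le> ?q" using elim by (simp add: le_log_iff)
    then have "2 ^ k \<le> ?q" by (simp add: powr_realpow)
    then have "3 * ln (real n) \<le> real n / 2 ^ (k + 3)"
      using elim by (simp add: field_simps power_add)
    then have "exp (- (real n / 2 ^ (k + 3))) \<le> exp (- (3 * ln (real n)))" by simp
    also have "\<dots> = 1 / real n ^ 3"
      using elim by (simp add: exp_minus exp_of_nat_mult[of 3, simplified] field_simps)
    finally have "2 * real (n + 1) ^ 2 * exp (- (real n / 2 ^ (k + 3)))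
        \<le> 2 * real (n + 1) ^ 2 * (1 / real n ^ 3)"
      by (intro mult_left_mono) auto
    also have "\<dots> = 2 * (real n + 1) ^ 2 / real n ^ 3" by (simp add: add.commute)
    finally have "1 - 2 * (real n + 1) ^ 2 / real n ^ 3
        \<le> 1 - 2 * real (n + 1) ^ 2 * exp (- (real n / 2 ^ (k + 3)))" by simp
    then have "log 2 ?q * (1 - 2 * (real n + 1) ^ 2 / real n ^ 3)
        \<le> real (k + 1) * (1 - 2 * real (n + 1) ^ 2 * exp (- (real n / 2 ^ (k + 3))))"
      using elim k by (intro mult_mono) auto
    also have "\<dots> \<le> mean_max_chain n"
      using elim by (intro mean_max_chain_lower) auto
    finally show ?case .
  qed
qed

text \<open>Both bounds differ from \<open>log 2 n\<close> by terms of order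
  \<open>log 2 (ln n)\<close>, which vanish after division.\<close>

lemma mean_max_chain_asymp_equiv: "mean_max_chain \<sim>[sequentially] (\<lambda>n. log 2 (real n))"
proof (rule asymp_equivI')
  show "(\<lambda>n. mean_max_chain n / log 2 (real n)) \<longlonglongrightarrow> 1"
  proof (rule tendsto_sandwich)
    have ev: "eventually (\<lambda>n. log 2 (real n) > 0) sequentially" by real_asymp
    show "eventually (\<lambda>n. log 2 (n / (24 * ln n)) * (1 - 2 * (real n + 1) ^ 2 / real n ^ 3) / log 2 n
        \<le> mean_max_chain n / log 2 (real n)) sequentially"
      using mean_max_chain_eventually_ge ev by eventually_elim (simp add: divide_right_mono)
    show "eventually (\<lambda>n. mean_max_chain n / log 2 (real n) \<le> ((log 2 n + log 2 (ln n) + 1)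
        + (n + 1) * (log 2 n + log 2 (ln n) + 4) / (2 * n * ln n)) / log 2 n) sequentially"
      using mean_max_chain_eventually_le ev by eventually_elim (simp add: divide_right_mono)
  qed real_asymp+
qed

lemma expected_max_eq: "expected_max n = mean_max_chain n"
  by (simp add: expected_max_def mean_max_chain_def catalan_def Av_312_eq card_image
      inj_on_lab sum.reindex max_sub_perm_213_lab)

theorem proposition2:
  shows "asymp_equiv expected_max sequentially (\<lambda>n. log 2 (real n))"
  using mean_max_chain_asymp_equiv by (simp add: expected_max_eq[abs_def])

end
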